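(* Let $X\subset\mathbb{R}$ be a Lusin set and let $Y\subset\mathbb{R}$ be a Sierpiński set. Then $X\times Y$ has the Menger property $\mathsf{S}_{fin}(\mathcal{O},\mathcal{O})$.
   Context: Sets of reals carry the subspace topology from $\mathbb{R}$, and $X\times Y$ carries the product topology. A set of real numbers is a Lusin set if it is uncountable but its intersection with each nowhere dense set (in $\mathbb{R}$) is countable. A set of real numbers is a Sierpiński set if it is uncountable but its intersection with each Lebesgue measure zero set is countable. $\mathcal{O}$ denotes the collection of all open covers of the space. A space has $\mathsf{S}_{fin}(\mathcal{O},\mathcal{O})$ (the Menger property) if for each sequence $(O_m:m<\infty)$ of open covers of the space there is a sequence $(T_m:m<\infty)$ with each $T_m$ a finite subset of $O_m$, such that $\bigcup\{T_m:m<\infty\}$ is an open cover of the space. *)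

theory Defs
  imports "HOL-Analysis.Analysis"
begin

definition nowhere_dense :: "'a::topological_space set \<Rightarrow> bool" where
  "nowhere_dense S \<longleftrightarrow> interior (closure S) = {}"

definition Lusin_set :: "real set \<Rightarrow> bool" where
  "Lusin_set X \<longleftrightarrow>
     uncountable X \<and> (\<forall>N. nowhere_dense N \<longrightarrow> countable (X \<inter> N))"

definition Sierpinski_set :: "real set \<Rightarrow> bool" where
  "Sierpinski_set Y \<longleftrightarrow>
     uncountable Y \<and> (\<forall>N \<in> null_sets lebesgue. countable (Y \<inter> N))"

definition open_covers :: "'a topology \<Rightarrow> 'a set set set" where
  "open_covers T = {\<U>. (\<forall>U \<in> \<U>. openin T U) \<and> \<Union>\<U> = topspace T}"

definition S_fin :: "'b set set \<Rightarrow> 'b set set \<Rightarrow> bool" where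
  "S_fin \<A> \<B> \<longleftrightarrow>
     (\<forall>Us :: nat \<Rightarrow> 'b set. (\<forall>m. Us m \<in> \<A>) \<longrightarrow>
       (\<exists>Ts :: nat \<Rightarrow> 'b set. (\<forall>m. finite (Ts m) \<and> Ts m \<subseteq> Us m) \<and> (\<Union>m. Ts m) \<in> \<B>))"

definition Menger_space :: "'a topology \<Rightarrow> bool" where
  "Menger_space T \<longleftrightarrow> S_fin (open_covers T) (open_covers T)"

end

theory Submission
  imports Defs
begin

text \<open>
  Both hypotheses say that certain exceptional sets of coordinates are countable, and the proof
  keeps the exceptions in \<open>X\<close> and in \<open>Y\<close> apart, so that only a countable set of pairs fails
  twice.

  Given open covers \<open>Us m\<close> of \<open>X \<times> Y\<close>, fix a countable dense \<open>D \<subseteq> X\<close>.  Stage \<open>m\<close> considers only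
  finitely many points of \<open>D\<close>.  The slices of \<open>\<Union>(Us m)\<close> over these points are open and contain
  \<open>Y\<close>, so by inner regularity one compact set \<open>K m\<close>, inside all these slices, contains
  \<open>Y \<inter> cball 0 m\<close> up to measure \<open>(1/2) ^ m\<close>.  Finitely many members of \<open>Us m\<close> cover the chosen
  points times \<open>K m\<close>, and by the tube lemma they cover \<open>P m \<times> K m\<close> for an open neighbourhood
  \<open>P m\<close> of the points (\<open>finite_selection_on_rectangle\<close>).  By Borel-Cantelli and the Sierpinski
  property, all but countably many \<open>y \<in> Y\<close> lie in \<open>K m\<close> for almost all \<open>m\<close>.  By density of \<open>D\<close> and
  the Lusin property, all but countably many \<open>x \<in> X\<close> lie in \<open>P m\<close> for infinitely many \<open>m\<close>.  Hence
  the selected sets cover \<open>(X - A) \<times> (Y - B)\<close> with \<open>A\<close> and \<open>B\<close> countable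
  (\<open>selection_up_to_countable_coordinates\<close>).  It is essential that \<open>K m\<close> serves all points of
  \<open>P m\<close> at once: otherwise \<open>B\<close> would vary with \<open>x\<close>.

  The remaining set, contained in \<open>A \<times> Y \<union> X \<times> B\<close>, may still be uncountable.  However, any
  prescribed countable sets of coordinates can be kept out of the exceptional sets, by adding
  them to \<open>D\<close> and, finitely many at a time, to the compact sets \<open>K m\<close>.  A second selection from
  the same covers, with exceptional sets \<open>A'\<close> and \<open>B'\<close> disjoint from \<open>A\<close> and \<open>B\<close>, leaves at most
  \<open>A \<times> B' \<union> A' \<times> B\<close> uncovered.  This set is countable, so one further member of each cover
  suffices.
\<close>

text \<open>
  Covers by open sets of the ambient space suffice.  They are needed because the compact
  approximations of \<open>Y\<close> in the measure argument need not be subsets of \<open>Y\<close>.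
\<close>

lemma Menger_space_top_of_setI:
  fixes S :: "'a::topological_space set"
  assumes "\<And>Us :: nat \<Rightarrow> 'a set set.
    (\<And>m U. U \<in> Us m \<Longrightarrow> open U) \<Longrightarrow> (\<And>m. S \<subseteq> \<Union>(Us m)) \<Longrightarrow>
    \<exists>Ts. (\<forall>m. finite (Ts m) \<and> Ts m \<subseteq> Us m) \<and> S \<subseteq> (\<Union>m. \<Union>(Ts m))"
  shows "Menger_space (top_of_set S)"
  unfolding Menger_space_def S_fin_def
proof (intro allI impI)
  fix Us :: "nat \<Rightarrow> 'a set set"
  assume Us: "\<forall>m. Us m \<in> open_covers (top_of_set S)"
  define Ws where "Ws m = {W. open W \<and> S \<inter> W \<in> Us m}" for m
  have "S \<subseteq> \<Union>(Ws m)" for m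
  proof
    fix x assume "x \<in> S"
    moreover have "\<Union>(Us m) = S" "\<forall>U\<in>Us m. openin (top_of_set S) U"
      using Us by (auto simp: open_covers_def)
    ultimately obtain U where U: "U \<in> Us m" "x \<in> U" "openin (top_of_set S) U" by blast
    then obtain W where "open W" "U = S \<inter> W" by (auto simp: openin_open)
    then show "x \<in> \<Union>(Ws m)" using U by (auto simp: Ws_def)
  qed
  moreover have "\<And>m W. W \<in> Ws m \<Longrightarrow> open W" by (simp add: Ws_def)
  ultimately have "\<exists>Ts. (\<forall>m. finite (Ts m) \<and> Ts m \<subseteq> Ws m) \<and> S \<subseteq> (\<Union>m. \<Union>(Ts m))"
    by (intro assms)
  then obtain Ts where Ts: "\<And>m. finite (Ts m)" "\<And>m. Ts m \<subseteq> Ws m"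
    "S \<subseteq> (\<Union>m. \<Union>(Ts m))" by metis
  define Rs where "Rs m = (\<inter>) S ` Ts m" for m
  have Rs: "\<forall>m. finite (Rs m) \<and> Rs m \<subseteq> Us m"
    using Ts(1,2) by (fastforce simp: Rs_def Ws_def)
  moreover have "(\<Union>m. Rs m) \<in> open_covers (top_of_set S)"
  proof -
    have "\<Union>(\<Union>m. Rs m) = S \<inter> (\<Union>m. \<Union>(Ts m))" by (auto simp: Rs_def)
    also have "\<dots> = S" using Ts(3) by (rule Int_absorb2)
    finally have "\<Union>(\<Union>m. Rs m) = S" .
    moreover have "openin (top_of_set S) U" if "U \<in> Us m" for m U
      using Us that by (simp add: open_covers_def)
    then have "\<forall>U\<in>\<Union>m. Rs m. openin (top_of_set S) U" using Rs by blast
    ultimately show ?thesis by (simp add: open_covers_def)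
  qed
  ultimately show "\<exists>Ts. (\<forall>m. finite (Ts m) \<and> Ts m \<subseteq> Us m) \<and>
      (\<Union>m. Ts m) \<in> open_covers (top_of_set S)" by blast
qed

lemma countable_selection:
  assumes "countable E" and "\<And>m. E \<subseteq> \<Union>(Us m)"
  obtains Ts :: "nat \<Rightarrow> 'a set set"
  where "\<And>m. finite (Ts m)" "\<And>m. Ts m \<subseteq> Us m" "E \<subseteq> (\<Union>m. \<Union>(Ts m))"
proof -
  define Ts where
    "Ts m = (if E = {} then {} else {SOME U. U \<in> Us m \<and> from_nat_into E m \<in> U})" for m
  have sel: "(SOME U. U \<in> Us m \<and> from_nat_into E m \<in> U) \<in> Us m \<and>
      from_nat_into E m \<in> (SOME U. U \<in> Us m \<and> from_nat_into E m \<in> U)" if "E \<noteq> {}" for m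
    by (rule someI_ex) (use from_nat_into[OF that, of m] assms(2)[of m] in blast)
  show ?thesis
  proof
    show "finite (Ts m)" for m by (simp add: Ts_def)
    show "Ts m \<subseteq> Us m" for m using sel[of m] by (auto simp: Ts_def)
    show "E \<subseteq> (\<Union>m. \<Union>(Ts m))"
    proof
      fix x assume "x \<in> E"
      then obtain m where "from_nat_into E m = x" using assms(1) by (meson from_nat_into_surj)
      then show "x \<in> (\<Union>m. \<Union>(Ts m))" using sel[of m] \<open>x \<in> E\<close> by (auto simp: Ts_def)
    qed
  qed
qed

lemma countable_finite_exhaustion:
  assumes "countable D"
  obtains F :: "nat \<Rightarrow> 'a set"
  where "\<And>m. finite (F m)" "\<And>m. F m \<subseteq> D" "\<And>d. d \<in> D \<Longrightarrow> eventually (\<lambda>m. d \<in> F m) sequentially"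
proof
  let ?F = "\<lambda>m. {d \<in> D. to_nat_on D d \<le> m}"
  show "finite (?F m)" for m
    by (rule inj_on_finite[of "to_nat_on D" _ "{..m}"])
       (use inj_on_to_nat_on[OF assms] in \<open>auto intro: inj_on_subset\<close>)
  show "eventually (\<lambda>m. d \<in> ?F m) sequentially" if "d \<in> D" for d
    using that by (auto simp: eventually_sequentially)
qed auto

text \<open>
  One stage of the selection.  The slices of \<open>\<Union>\<U>\<close> over \<open>D\<close> have an open intersection
  containing \<open>Y\<close>, and \<open>K\<close> is a compact approximation of it from inside, so that \<open>N\<close> is the
  part that the approximation loses.  Being finite, \<open>C\<close> can be added to
  \<open>K\<close> without destroying compactness.
\<close>

lemma finite_selection_on_rectangle:
  fixes \<U> :: "('a::topological_space \<times> 'b::euclidean_space) set set"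
  assumes "\<And>U. U \<in> \<U> \<Longrightarrow> open U" and cover: "D \<times> Y \<subseteq> \<Union>\<U>"
    and "finite D" "finite C" "C \<subseteq> Y" and "e > 0"
  obtains \<T> P K N where "finite \<T>" "\<T> \<subseteq> \<U>" "open P" "D \<subseteq> P" "C \<subseteq> K" "P \<times> K \<subseteq> \<Union>\<T>"
    "Y \<inter> cball 0 r \<subseteq> K \<union> N" "N \<in> sets lebesgue" "emeasure lebesgue N < ennreal e"
proof -
  define V where "V = (\<Inter>d\<in>D. Pair d -` \<Union>\<U>)"
  have "open V"
    unfolding V_def using assms(1,3)
    by (intro open_INT ballI open_vimage open_Union continuous_intros) auto
  have "Y \<subseteq> V" using cover by (auto simp: V_def)
  have "V \<in> sets lebesgue" using \<open>open V\<close> by (simp add: borel_open sets_completionI_sets)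
  then obtain L where L: "closed L" "L \<subseteq> V" "V - L \<in> lmeasurable"
      "emeasure lebesgue (V - L) < ennreal e"
    using sets_lebesgue_inner_closed[OF _ \<open>e > 0\<close>] by metis
  define K where "K = (L \<inter> cball 0 r) \<union> C"
  have "compact K"
    unfolding K_def
    by (intro compact_Un closed_Int_compact L(1) compact_cball finite_imp_compact \<open>finite C\<close>)
  have "K \<subseteq> V" using L(2) \<open>C \<subseteq> Y\<close> \<open>Y \<subseteq> V\<close> by (auto simp: K_def)
  then have "D \<times> K \<subseteq> \<Union>\<U>" by (auto simp: V_def)
  moreover have "compact (D \<times> K)"
    using \<open>finite D\<close> \<open>compact K\<close> by (simp add: compact_Times finite_imp_compact)
  ultimately obtain \<T> where T: "finite \<T>" "\<T> \<subseteq> \<U>" "D \<times> K \<subseteq> \<Union>\<T>"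
    using assms(1) by (meson compactE)
  have "open (\<Union>\<T>)" using T(2) assms(1) by blast
  have "\<exists>Q. d \<in> Q \<and> open Q \<and> Q \<times> K \<subseteq> \<Union>\<T>" if "d \<in> D" for d
  proof (rule Elementary_Topology.tube_lemma[OF \<open>compact K\<close> \<open>open (\<Union>\<T>)\<close>])
    show "{d} \<times> K \<subseteq> \<Union>\<T>" by (rule order_trans[OF Sigma_mono T(3)]) (use that in auto)
  qed
  then obtain Q where Q: "\<And>d. d \<in> D \<Longrightarrow> d \<in> Q d" "\<And>d. d \<in> D \<Longrightarrow> open (Q d)"
      "\<And>d. d \<in> D \<Longrightarrow> Q d \<times> K \<subseteq> \<Union>\<T>" by metis
  show ?thesis
  proof
    show "open (\<Union>d\<in>D. Q d)" using Q(2) by blast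
    show "D \<subseteq> (\<Union>d\<in>D. Q d)" using Q(1) by blast
    have "(\<Union>d\<in>D. Q d) \<times> K = (\<Union>d\<in>D. Q d \<times> K)" by blast
    then show "(\<Union>d\<in>D. Q d) \<times> K \<subseteq> \<Union>\<T>" using Q(3) by (simp add: UN_least)
    show "Y \<inter> cball 0 r \<subseteq> K \<union> (V - L)" using \<open>Y \<subseteq> V\<close> by (auto simp: K_def)
    show "C \<subseteq> K" by (simp add: K_def)
    show "V - L \<in> sets lebesgue" using L(3) by blast
  qed (use T L in auto)
qed

text \<open>
  The set misses the points of \<open>D\<close>, and a nonempty open set inside its closure would have
  to contain one of them.
\<close>

lemma nowhere_dense_Diff_open_superset_dense:
  assumes "open P" "D \<subseteq> P" "X \<subseteq> closure D"
  shows "nowhere_dense (X - P)"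
proof -
  let ?I = "interior (closure (X - P))"
  have "X - P \<subseteq> - P" by auto
  then have "closure (X - P) \<subseteq> - P" using \<open>open P\<close> by (simp add: closure_minimal closed_Compl)
  then have "?I \<inter> D = {}" using \<open>D \<subseteq> P\<close> interior_subset by blast
  then have "?I \<inter> closure D = {}" using open_Int_closure_eq_empty[OF open_interior] by blast
  moreover have "?I \<subseteq> closure D"
    using interior_subset closure_mono[of "X - P" "closure D"] assms(3) by fastforce
  ultimately show ?thesis unfolding nowhere_dense_def by blast
qed

text \<open>
  The stages are combined so that a point \<open>(x, y)\<close> is covered once \<open>x\<close> lies in infinitely many of
  the sets \<open>P m\<close> and \<open>y\<close> in almost all of the sets \<open>K m\<close>.  The countable sets \<open>D\<close> and \<open>C\<close> are
  coordinates that the caller wants handled without exception.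
\<close>

lemma selection_up_to_countable_coordinates:
  fixes X :: "'a::{metric_space,second_countable_topology} set" and Y :: "'b::euclidean_space set"
  assumes X: "\<And>N. nowhere_dense N \<Longrightarrow> countable (X \<inter> N)"
    and Y: "\<And>N. N \<in> null_sets lebesgue \<Longrightarrow> countable (Y \<inter> N)"
    and op: "\<And>m. \<forall>U\<in>Us m. open U" and cover: "\<And>m. X \<times> Y \<subseteq> \<Union>(Us m)"
    and D: "countable D" "D \<subseteq> X" and C: "countable C" "C \<subseteq> Y"
  obtains Ts :: "nat \<Rightarrow> ('a \<times> 'b) set set" and A B
  where "\<And>m. finite (Ts m)" "\<And>m. Ts m \<subseteq> Us m" "countable A" "countable B"
    "A \<inter> D = {}" "B \<inter> C = {}" "(X - A) \<times> (Y - B) \<subseteq> (\<Union>m. \<Union>(Ts m))"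
proof -
  obtain E0 where E0: "countable E0" "E0 \<subseteq> X" "X \<subseteq> closure E0" using separable by blast
  define E where "E = D \<union> E0"
  have E: "countable E" "E \<subseteq> X" "X \<subseteq> closure E"
    using E0 D closure_mono[of E0 E] by (auto simp: E_def)
  obtain F where F: "\<And>m. finite (F m)" "\<And>m. F m \<subseteq> E"
      "\<And>d. d \<in> E \<Longrightarrow> eventually (\<lambda>m. d \<in> F m) sequentially"
    using countable_finite_exhaustion[OF E(1)] by metis
  obtain G where G: "\<And>m. finite (G m)" "\<And>m. G m \<subseteq> C"
      "\<And>d. d \<in> C \<Longrightarrow> eventually (\<lambda>m. d \<in> G m) sequentially"
    using countable_finite_exhaustion[OF C(1)] by metis
  have "\<exists>T P K N. finite T \<and> T \<subseteq> Us m \<and> open P \<and> F m \<subseteq> P \<and> G m \<subseteq> K \<and> P \<times> K \<subseteq> \<Union>T \<and>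
      Y \<inter> cball 0 (real m) \<subseteq> K \<union> N \<and> N \<in> sets lebesgue \<and>
      emeasure lebesgue N < ennreal ((1/2) ^ m)" for m
  proof -
    have "F m \<times> Y \<subseteq> \<Union>(Us m)" "G m \<subseteq> Y" using F(2)[of m] G(2)[of m] E(2) C(2) cover[of m] by blast+
    moreover have "(0::real) < (1/2) ^ m" by simp
    ultimately obtain T P K N where "finite T" "T \<subseteq> Us m" "open P" "F m \<subseteq> P" "G m \<subseteq> K"
        "P \<times> K \<subseteq> \<Union>T" "Y \<inter> cball 0 (real m) \<subseteq> K \<union> N" "N \<in> sets lebesgue"
        "emeasure lebesgue N < ennreal ((1/2) ^ m)"
      using finite_selection_on_rectangle[OF bspec[OF op] _ F(1) G(1), where r = "real m"] by metis
    then show ?thesis by blast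
  qed
  then obtain Ts P K N where st: "\<And>m. finite (Ts m)" "\<And>m. Ts m \<subseteq> Us m" "\<And>m. open (P m)"
      "\<And>m. F m \<subseteq> P m" "\<And>m. G m \<subseteq> K m" "\<And>m. P m \<times> K m \<subseteq> \<Union>(Ts m)"
      "\<And>m. Y \<inter> cball 0 (real m) \<subseteq> K m \<union> N m" "\<And>m. N m \<in> sets lebesgue"
      "\<And>m. emeasure lebesgue (N m) < ennreal ((1/2) ^ m)"
    by metis
  define A where "A = {x \<in> X. \<not> frequently (\<lambda>m. x \<in> P m) sequentially}"
  define B where "B = {y \<in> Y. \<not> eventually (\<lambda>m. y \<in> K m) sequentially}"

  \<comment> \<open>Each tail union of the \<open>P m\<close> is open and contains the dense set \<open>E\<close>, so the part of \<open>X\<close>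
      outside it is nowhere dense.\<close>
  have "countable A"
  proof -
    have "countable (X \<inter> (X - (\<Union>m\<in>{k..}. P m)))" for k
    proof (intro X nowhere_dense_Diff_open_superset_dense[OF _ _ E(3)])
      show "open (\<Union>m\<in>{k..}. P m)" using st(3) by blast
      show "E \<subseteq> (\<Union>m\<in>{k..}. P m)"
      proof
        fix d assume "d \<in> E"
        then have "eventually (\<lambda>m. d \<in> F m \<and> k \<le> m) sequentially"
          using F(3) eventually_ge_at_top by (simp add: eventually_conj)
        then obtain m where "k \<le> m" "d \<in> F m"
          using eventually_happens'[OF sequentially_bot] by blast
        then show "d \<in> (\<Union>m\<in>{k..}. P m)" using st(4) by blast
      qed
    qed
    then have "countable (\<Union>k. X \<inter> (X - (\<Union>m\<in>{k..}. P m)))"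
      by (intro countable_UN countableI_type)
    moreover have "A \<subseteq> (\<Union>k. X \<inter> (X - (\<Union>m\<in>{k..}. P m)))"
      by (auto simp: A_def frequently_def eventually_sequentially)
    ultimately show ?thesis by (rule countable_subset[rotated])
  qed

  \<comment> \<open>Every \<open>y\<close> lies in \<open>cball 0 m\<close> for large \<open>m\<close>, so missing \<open>K m\<close>
      infinitely often means lying in \<open>N m\<close> infinitely often.\<close>
  have "countable B"
  proof -
    have "limsup N \<in> null_sets lebesgue"
    proof (rule borel_cantelli_limsup1)
      show "N m \<in> sets lebesgue" for m by (rule st(8))
      show "emeasure lebesgue (N m) < \<infinity>" for m
        using st(9)[of m] by (simp add: order.strict_trans)
      have "measure lebesgue (N m) \<le> (1/2) ^ m" for m
        using st(9)[of m] by (simp add: measure_def enn2real_leI)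
      then show "summable (\<lambda>m. measure lebesgue (N m))"
        by (intro summable_comparison_test'[OF summable_geometric[of "1/2::real"], of 0]) auto
    qed
    moreover have "B \<subseteq> Y \<inter> limsup N"
    proof
      fix y assume y: "y \<in> B"
      have "eventually (\<lambda>m. norm y \<le> real m) sequentially"
        using eventually_ge_at_top[of "nat \<lceil>norm y\<rceil>"] by eventually_elim linarith
      moreover have "frequently (\<lambda>m. y \<notin> K m) sequentially"
        using y by (simp add: B_def not_eventually)
      ultimately have "frequently (\<lambda>m. norm y \<le> real m \<and> y \<notin> K m) sequentially"
        by (rule frequently_eventually_conj[rotated])
      moreover have "y \<in> N m" if "norm y \<le> real m \<and> y \<notin> K m" for m
        using st(7)[of m] y that by (auto simp: B_def)
      ultimately have "frequently (\<lambda>m. y \<in> N m) sequentially"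
        by (rule frequently_elim1)
      then show "y \<in> Y \<inter> limsup N"
        using y by (auto simp: B_def limsup_INF_SUP frequently_def eventually_sequentially)
    qed
    ultimately show ?thesis using Y countable_subset by blast
  qed

  have "A \<inter> D = {}"
  proof -
    have "frequently (\<lambda>m. d \<in> P m) sequentially" if "d \<in> D" for d
    proof (rule eventually_frequently[OF sequentially_bot])
      have "eventually (\<lambda>m. d \<in> F m) sequentially" using F(3) that by (simp add: E_def)
      then show "eventually (\<lambda>m. d \<in> P m) sequentially"
        by (rule eventually_mono) (use st(4) in blast)
    qed
    then show ?thesis by (auto simp: A_def)
  qed
  moreover have "B \<inter> C = {}"
  proof -
    have "eventually (\<lambda>m. c \<in> K m) sequentially" if "c \<in> C" for c
      by (rule eventually_mono[OF G(3)[OF that]]) (use st(5) in blast)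
    then show ?thesis by (auto simp: B_def)
  qed
  moreover have "(X - A) \<times> (Y - B) \<subseteq> (\<Union>m. \<Union>(Ts m))"
  proof clarify
    fix x y assume "x \<in> X" "x \<notin> A" "y \<in> Y" "y \<notin> B"
    then have "frequently (\<lambda>m. x \<in> P m) sequentially" "eventually (\<lambda>m. y \<in> K m) sequentially"
      by (auto simp: A_def B_def)
    then have "frequently (\<lambda>m. y \<in> K m \<and> x \<in> P m) sequentially"
      by (rule frequently_eventually_conj)
    then obtain m where "x \<in> P m" "y \<in> K m" using frequently_ex by blast
    then show "(x, y) \<in> (\<Union>m. \<Union>(Ts m))" using st(6) by blast
  qed
  ultimately show ?thesis using that st(1,2) \<open>countable A\<close> \<open>countable B\<close> by blast
qed

theorem corollary12:
  fixes X Y :: "real set"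
  assumes "Lusin_set X" and "Sierpinski_set Y"
  shows "Menger_space (prod_topology (top_of_set X) (top_of_set Y))"
proof -
  have X: "\<And>N. nowhere_dense N \<Longrightarrow> countable (X \<inter> N)"
    using assms(1) by (simp add: Lusin_set_def)
  have Y: "\<And>N. N \<in> null_sets lebesgue \<Longrightarrow> countable (Y \<inter> N)"
    using assms(2) by (simp add: Sierpinski_set_def)
  have "Menger_space (top_of_set (X \<times> Y))"
  proof (rule Menger_space_top_of_setI)
    fix Us :: "nat \<Rightarrow> (real \<times> real) set set"
    assume Us: "\<And>m U. U \<in> Us m \<Longrightarrow> open U" "\<And>m. X \<times> Y \<subseteq> \<Union>(Us m)"
    then have op: "\<And>m. \<forall>U\<in>Us m. open U" by blast
    obtain Ts A B where T: "\<And>m. finite (Ts m)" "\<And>m. Ts m \<subseteq> Us m" "countable A" "countable B"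
        "(X - A) \<times> (Y - B) \<subseteq> (\<Union>m. \<Union>(Ts m))"
      using selection_up_to_countable_coordinates[where Us = Us and D = "{}" and C = "{}",
          OF X Y op Us(2)] by auto
    \<comment> \<open>The exceptions of the first selection are the prescribed coordinates of the second.\<close>
    obtain Ts' A' B' where T': "\<And>m. finite (Ts' m)" "\<And>m. Ts' m \<subseteq> Us m"
        "countable A'" "countable B'" "A' \<inter> (X \<inter> A) = {}" "B' \<inter> (Y \<inter> B) = {}"
        "(X - A') \<times> (Y - B') \<subseteq> (\<Union>m. \<Union>(Ts' m))"
      using selection_up_to_countable_coordinates[where Us = Us and D = "X \<inter> A" and C = "Y \<inter> B",
          OF X Y op Us(2)] T(3,4) by auto
    define R where "R = (X \<times> Y) \<inter> (A \<times> B' \<union> A' \<times> B)"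
    have "countable R" using T(3,4) T'(3,4) unfolding R_def by blast
    moreover have "R \<subseteq> \<Union>(Us m)" for m using Us(2) by (auto simp: R_def)
    ultimately obtain Ts'' where T'': "\<And>m. finite (Ts'' m)" "\<And>m. Ts'' m \<subseteq> Us m"
        "R \<subseteq> (\<Union>m. \<Union>(Ts'' m))"
      using countable_selection[of R Us] by blast
    have "X \<times> Y \<subseteq> (X - A) \<times> (Y - B) \<union> (X - A') \<times> (Y - B') \<union> R"
      using T'(5,6) unfolding R_def by blast
    also have "\<dots> \<subseteq> (\<Union>m. \<Union>(Ts m)) \<union> (\<Union>m. \<Union>(Ts' m)) \<union> (\<Union>m. \<Union>(Ts'' m))"
      by (intro Un_mono T(5) T'(7) T''(3))
    also have "\<dots> = (\<Union>m. \<Union>(Ts m \<union> Ts' m \<union> Ts'' m))" by auto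
    finally have "X \<times> Y \<subseteq> (\<Union>m. \<Union>(Ts m \<union> Ts' m \<union> Ts'' m))" .
    then show "\<exists>Ts. (\<forall>m. finite (Ts m) \<and> Ts m \<subseteq> Us m) \<and> X \<times> Y \<subseteq> (\<Union>m. \<Union>(Ts m))"
      using T(1,2) T'(1,2) T''(1,2) by (intro exI[of _ "\<lambda>m. Ts m \<union> Ts' m \<union> Ts'' m"]) auto
  qed
  then show ?thesis by simp
qed

end
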